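(* Let $D$ be an open set in $\mathbb{R}^n$ (possibly unbounded and disconnected) and let $d(D):=\sup_{x\in D}\mathrm{dist}(x,D^c)$ be the width of $D$. Assume that $\overline D$ is disjoint from an infinite open domain $\Gamma\subset\overline D^{\,c}$ satisfying $$\frac{|\Gamma\cap(B_{c_1r_x}(x)\setminus B_{r_x}(x))|}{|B_{c_1r_x}(x)\setminus B_{r_x}(x)|}\ge c_0>0\qquad\forall\,x\in D$$ for some constants $c_1>1$, $c_0>0$ independent of $x$, with $r_x=\mathrm{dist}(x,D^c)\le d(D)$. Then there is a constant $C>0$, depending only on $n,s,\theta,\Theta,c_0,c_1$, such that the following holds. Suppose that $u\in\mathcal{L}_s(\mathbb{R}^n)\cap C^{1,1}_{loc}(D)$ is bounded from above and satisfies $$\begin{cases}\mathrm{F}_su(x)-c(x)u(x)\ge 0 & \text{at points } x\in D \text{ where } u(x)>0,\\ u(x)\le 0 & \text{in } D^c,\end{cases}$$ where $c(x)$ is uniformly bounded from below (w.r.t. $d(D)$) in $\{x\in D : u(x)>0\}$. If $$\inf_{\{x\in D : u(x)>0\}}c(x)>-\frac{C}{4\,d(D)^{2s}},$$ then $u(x)\le 0$ in $D$. Furthermore, assume in addition that $\mathrm{F}_su(x)\ge 0$ at points $x\in D$ where $u(x)=0$. Then either $u(x)<0$ in $D$ or $u(x)=0$ a.e. in $\mathbb{R}^n$.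
   Context: Let $n\ge 2$, $0<s<1$ and $0<\theta\le\Theta<\infty$. $\mathcal{L}_s(\mathbb{R}^n)$ is the set of functions $u:\mathbb{R}^n\to\mathbb{R}$ with $\int_{\mathbb{R}^n}\frac{|u(x)|}{1+|x|^{n+2s}}\,dx<+\infty$. $C^{1,1}_{loc}(D)$ denotes functions that are $C^1$ with locally Lipschitz gradient in $D$. For $u\in\mathcal{L}_s(\mathbb{R}^n)$ that is $C^{1,1}$ near $x$, $$\mathrm{F}_su(x):=\inf\left\{P.V.\int_{\mathbb{R}^n}\frac{u(y)-u(x)}{|A^{-1}(y-x)|^{n+2s}}\,dy \;:\; A \text{ a real symmetric } n\times n \text{ matrix},\ \theta I\le A\le\Theta I\right\}.$$ P.V. denotes the Cauchy principal value; $|\cdot|$ of a set denotes Lebesgue measure; $B_r(x)$ is the ball of radius $r$ centered at $x$; $D^c:=\mathbb{R}^n\setminus D$; "infinite" domain means unbounded domain. *)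

theory Defs
  imports "HOL-Analysis.Analysis"
begin

text \<open>Measurability of \<open>u\<close> is stated separately because integrability of
  \<open>\<bar>u\<bar> / \<dots>\<close> alone only gives measurability of \<open>\<bar>u\<bar>\<close>.\<close>

definition Ls_space :: "real \<Rightarrow> (real ^ 'n \<Rightarrow> real) set" where
  "Ls_space s = {u. u \<in> borel_measurable lebesgue \<and>
     integrable lebesgue
       (\<lambda>x. \<bar>u x\<bar> / (1 + norm x powr (real CARD('n) + 2 * s)))}"

definition C11_loc :: "(real ^ 'n) set \<Rightarrow> (real ^ 'n \<Rightarrow> real) set" where
  "C11_loc D = {u. \<exists>g :: real ^ 'n \<Rightarrow> real ^ 'n.
     (\<forall>x\<in>D. GDERIV u x :> g x) \<and> continuous_on D g \<and>
     (\<forall>x\<in>D. \<exists>e>0. \<exists>L. L-lipschitz_on (ball x e \<inter> D) g)}"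

definition elliptic_matrices :: "real \<Rightarrow> real \<Rightarrow> (real ^ 'n ^ 'n) set" where
  "elliptic_matrices \<theta> \<Theta> = {A. transpose A = A \<and>
     (\<forall>v. \<theta> * (v \<bullet> v) \<le> v \<bullet> (A *v v) \<and> v \<bullet> (A *v v) \<le> \<Theta> * (v \<bullet> v))}"

definition principal_value :: "(real ^ 'n \<Rightarrow> real) \<Rightarrow> real ^ 'n \<Rightarrow> real" where
  "principal_value f x =
     Lim (at_right 0) (\<lambda>e. LINT y:(- ball x e)|lebesgue. f y)"

text \<open>The limit and the real infimum below are meaningful when \<open>u\<close> lies in
  \<open>Ls_space s\<close> and is of class \<open>C\<^sup>1\<^sup>,\<^sup>1\<close> near \<open>x\<close>: each principal value then
  exists, and the values are bounded uniformly in \<open>A\<close>.\<close>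

definition Fs :: "real \<Rightarrow> real \<Rightarrow> real \<Rightarrow> (real ^ 'n \<Rightarrow> real) \<Rightarrow> real ^ 'n \<Rightarrow> real" where
  "Fs s \<theta> \<Theta> u x =
     (INF A\<in>elliptic_matrices \<theta> \<Theta>.
        principal_value
          (\<lambda>y. (u y - u x) / norm (matrix_inv A *v (y - x)) powr (real CARD('n) + 2 * s)) x)"

text \<open>The width may be infinite.  Note that \<open>infdist x (- D)\<close> is the distance to
  the complement only if \<open>D \<noteq> UNIV\<close>.\<close>

definition width :: "(real ^ 'n) set \<Rightarrow> ereal" where
  "width D = (SUP x\<in>D. ereal (infdist x (- D)))"

text \<open>Power of an extended nonnegative real with positive exponent; the (irrelevant)
  base \<open>-\<infinity>\<close>, which is the width of the empty set, is sent to \<open>0\<close>.\<close>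

definition ereal_powr :: "ereal \<Rightarrow> real \<Rightarrow> ereal" where
  "ereal_powr d p = (if d = \<infinity> then \<infinity> else ereal (real_of_ereal d powr p))"

end

theory Submission
  imports Defs
begin

text \<open>Since \<open>\<theta> I\<close> is an admissible matrix, the infimum \<open>Fs\<close> is at most a multiple of
  the fractional Laplacian; this only requires that the principal values are bounded below uniformly
  in \<open>A\<close>.  Suppose \<open>M = sup u > 0\<close>.  As the supremum need not be attained, pick \<open>x0\<close> with \<open>u x0\<close>
  close to \<open>M\<close>, let \<open>r\<close> be its distance to the complement of \<open>D\<close>, and add the concave paraboloid
  \<open>\<epsilon> M (1 - 4 |y - x0|\<^sup>2 / r\<^sup>2)\<close>.  The sum attains its global maximum at some \<open>x\<close> with
  \<open>|x - x0| < r / 2\<close>.  There the part of the fractional Laplacian over \<open>\<Gamma>\<close> contributes at most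
  a negative multiple of \<open>M r powr (- 2 s)\<close>, while everything else is at most \<open>\<epsilon>\<close> times
  such a quantity.  For fixed small \<open>\<epsilon>\<close> this forces \<open>c x \<le> - C r powr (- 2 s)\<close>, contradicting
  the lower bound on \<open>c\<close>.  At a zero of a nonpositive \<open>u\<close> the truncated integrals are nonpositive and
  decrease as the truncation radius shrinks, so a nonnegative limit makes all of them vanish.\<close>

section \<open>Integrals of powers of the norm over balls and their complements\<close>

lemma integrable_of_nn_integral_le:
  fixes f :: "'a \<Rightarrow> real"
  assumes "f \<in> borel_measurable M" "\<And>x. 0 \<le> f x" "(\<integral>\<^sup>+x. ennreal (f x) \<partial>M) \<le> ennreal c" "0 \<le> c"
  shows "integrable M f" "integral\<^sup>L M f \<le> c"
proof -
  show "integrable M f"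
    using assms by (intro integrableI_bounded) (auto simp: order_le_less_trans)
  show "integral\<^sup>L M f \<le> c"
    using assms by (simp add: integral_eq_nn_integral enn2real_leI)
qed

text \<open>On the annulus the integrand is at most its value \<open>R powr - p\<close> at the inner
  radius, and the annulus lies in \<open>ball x (2 * R)\<close>, whose volume supplies the power of
  \<open>R\<close>.\<close>

lemma nn_integral_norm_powr_annulus_le:
  fixes x :: "'a::euclidean_space"
  assumes "0 \<le> p" "0 < R"
  shows "(\<integral>\<^sup>+y. ennreal (norm (y - x) powr - p) * indicator {y. R \<le> norm (y - x) \<and> norm (y - x) < 2 * R} y \<partial>lborel)
    \<le> ennreal (unit_ball_vol (real DIM('a)) * 2 ^ DIM('a) * R powr (real DIM('a) - p))"
proof -
  have "(\<integral>\<^sup>+y. ennreal (norm (y - x) powr - p) * indicator {y. R \<le> norm (y - x) \<and> norm (y - x) < 2 * R} y \<partial>lborel)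
    \<le> (\<integral>\<^sup>+y. ennreal (R powr - p) * indicator (ball x (2 * R)) y \<partial>lborel)"
    using assms
    by (intro nn_integral_mono)
      (auto simp: indicator_def dist_norm norm_minus_commute intro!: ennreal_leI powr_mono2')
  also have "\<dots> = ennreal (R powr - p) * emeasure lborel (ball x (2 * R))"
    by (subst nn_integral_cmult_indicator) auto
  also have "\<dots> = ennreal (R powr - p * (unit_ball_vol (real DIM('a)) * (2 * R) ^ DIM('a)))"
    using assms by (simp add: emeasure_ball ennreal_mult)
  also have "R powr - p * (unit_ball_vol (real DIM('a)) * (2 * R) ^ DIM('a)) =
      unit_ball_vol (real DIM('a)) * 2 ^ DIM('a) * R powr (real DIM('a) - p)"
    using assms by (simp add: power_mult_distrib powr_diff powr_minus powr_realpow field_simps)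
  finally show ?thesis .
qed

text \<open>The bounds on the annuli of radii \<open>\<delta> * \<rho> ^ k\<close> form a geometric
  series of ratio \<open>\<rho> powr (n - p)\<close>, with \<open>n\<close> the dimension, and
  \<open>C\<close> is its sum. The form with general \<open>\<rho>\<close> serves both tails
  (\<open>\<rho> = 2\<close>, \<open>n < p\<close>) and punctured balls
  (\<open>\<rho> = 1 / 2\<close>, \<open>p < n\<close>).\<close>

lemma norm_powr_integral_geometric:
  fixes x :: "'a::euclidean_space"
  assumes "0 \<le> p" "0 < \<rho>" "0 < \<delta>" and q: "\<rho> powr (real DIM('a) - p) < 1"
    and S: "S \<in> sets borel"
    and cover: "\<And>y. y \<in> S \<Longrightarrow> y \<noteq> x \<Longrightarrow> \<exists>k. \<delta> * \<rho> ^ k \<le> norm (y - x) \<and> norm (y - x) < 2 * (\<delta> * \<rho> ^ k)"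
  defines "C \<equiv> unit_ball_vol (real DIM('a)) * 2 ^ DIM('a) / (1 - \<rho> powr (real DIM('a) - p))
      * \<delta> powr (real DIM('a) - p)"
  shows "integrable lebesgue (\<lambda>y. indicator S y * norm (y - x) powr - p)"
    and "(\<integral>y. indicator S y * norm (y - x) powr - p \<partial>lebesgue) \<le> C"
proof -
  let ?n = "real DIM('a)" let ?V = "unit_ball_vol (real DIM('a)) * 2 ^ DIM('a)"
  let ?f = "\<lambda>y. ennreal (norm (y - x) powr - p)"
  let ?A = "\<lambda>k. {y. \<delta> * \<rho> ^ k \<le> norm (y - x) \<and> norm (y - x) < 2 * (\<delta> * \<rho> ^ k)}"
  let ?q = "\<rho> powr (?n - p)"
  have [measurable]: "?A k \<in> sets borel" for k by measurable
  have scale: "?V * (\<delta> * \<rho> ^ k) powr (?n - p) = ?V * \<delta> powr (?n - p) * ?q ^ k" for k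
    using assms by (simp add: powr_mult powr_realpow[symmetric] powr_powr mult.commute)
  have "C \<ge> 0" using q unfolding C_def by simp
  have "(\<integral>\<^sup>+y. ennreal (indicator S y * norm (y - x) powr - p) \<partial>lebesgue)
      = (\<integral>\<^sup>+y. ennreal (indicator S y * norm (y - x) powr - p) \<partial>lborel)"
    by (rule nn_integral_completion)
  also have "\<dots> \<le> (\<integral>\<^sup>+y. (\<Sum>k. ?f y * indicator (?A k) y) \<partial>lborel)"
  proof (rule nn_integral_mono)
    fix y
    show "ennreal (indicator S y * norm (y - x) powr - p) \<le> (\<Sum>k. ?f y * indicator (?A k) y)"
    \<comment> \<open>No annulus contains the centre, but \<open>0 powr - p\<close> is
      \<open>0\<close>, so the integrand vanishes there.\<close>
    proof (cases "y \<in> S \<and> y \<noteq> x")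
      case True
      then obtain k where k: "y \<in> ?A k" using cover by blast
      have "ennreal (indicator S y * norm (y - x) powr - p) = ?f y * indicator (?A k) y"
        using True k by simp
      also have "\<dots> \<le> (\<Sum>k. ?f y * indicator (?A k) y)"
        using sum_le_suminf[OF summableI, of "{k}" "\<lambda>k. ?f y * indicator (?A k) y"]
        by (simp only: sum.insert sum.empty finite.intros empty_iff not_False_eq_True add_0_right zero_le simp_thms)
      finally show ?thesis .
    qed auto
  qed
  also have "\<dots> = (\<Sum>k. \<integral>\<^sup>+y. ?f y * indicator (?A k) y \<partial>lborel)"
    by (rule nn_integral_suminf) measurable
  also have "\<dots> \<le> (\<Sum>k. ennreal (?V * \<delta> powr (?n - p) * ?q ^ k))"
    using assms nn_integral_norm_powr_annulus_le[of p "\<delta> * \<rho> ^ k" x for k]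
    by (intro suminf_le summableI) (simp add: scale)
  also have "\<dots> = ennreal (\<Sum>k. ?V * \<delta> powr (?n - p) * ?q ^ k)"
    using q by (intro suminf_ennreal2) (auto intro!: summable_mult summable_geometric)
  also have "(\<Sum>k. ?V * \<delta> powr (?n - p) * ?q ^ k) = C"
    using q by (subst suminf_mult) (auto intro!: summable_geometric simp: suminf_geometric C_def)
  finally have "(\<integral>\<^sup>+y. ennreal (indicator S y * norm (y - x) powr - p) \<partial>lebesgue) \<le> ennreal C" .
  note * = integrable_of_nn_integral_le[OF _ _ this \<open>C \<ge> 0\<close>]
  note S[measurable]
  have "(\<lambda>y. indicator S y * norm (y - x) powr - p) \<in> borel_measurable borel" by measurable
  then have m: "(\<lambda>y. indicator S y * norm (y - x) powr - p) \<in> borel_measurable lebesgue"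
    by (simp add: measurable_completion)
  show "integrable lebesgue (\<lambda>y. indicator S y * norm (y - x) powr - p)"
    and "(\<integral>y. indicator S y * norm (y - x) powr - p \<partial>lebesgue) \<le> C"
    by (rule *[OF m]; simp)+
qed

lemma norm_powr_integral_outside_ball:
  assumes "real DIM('a) < p"
  obtains C where "0 < C"
    "\<And>(x::'a::euclidean_space) \<delta>. 0 < \<delta> \<Longrightarrow> integrable lebesgue (\<lambda>y. indicator (- ball x \<delta>) y * norm (y - x) powr - p)"
    "\<And>(x::'a) \<delta>. 0 < \<delta> \<Longrightarrow> (\<integral>y. indicator (- ball x \<delta>) y * norm (y - x) powr - p \<partial>lebesgue)
        \<le> C * \<delta> powr (real DIM('a) - p)"
proof -
  have q: "2 powr (real DIM('a) - p) < (1::real)" using assms by (simp add: powr_less_one)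
  have cover: "\<exists>k. \<delta> * 2 ^ k \<le> norm (y - x) \<and> norm (y - x) < 2 * (\<delta> * 2 ^ k)"
    if "0 < \<delta>" "y \<in> - ball x \<delta>" for x y :: 'a and \<delta>
  proof -
    let ?P = "\<lambda>k. norm (y - x) < 2 * (\<delta> * 2 ^ k)"
    obtain n where "norm (y - x) / (2 * \<delta>) < 2 ^ n" using real_arch_pow[of 2] by auto
    then have n: "?P n" using that by (simp add: field_simps)
    \<comment> \<open>The outer radius at index \<open>j\<close> is the inner radius at
      \<open>Suc j\<close>, so failure of \<open>?P j\<close> is the inner bound; at index
      \<open>0\<close> the inner bound says that \<open>y\<close> is outside the ball.\<close>
    have "\<delta> * 2 ^ (LEAST k. ?P k) \<le> norm (y - x)"
    proof (cases "LEAST k. ?P k")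
      case 0 then show ?thesis using that by (simp add: dist_norm norm_minus_commute)
    next
      case (Suc j)
      then have "\<not> ?P j" by (metis lessI not_less_Least)
      then show ?thesis using Suc by simp
    qed
    with LeastI[of ?P, OF n] show ?thesis by blast
  qed
  let ?K = "unit_ball_vol (real DIM('a)) * 2 ^ DIM('a) / (1 - 2 powr (real DIM('a) - p))"
  have p: "0 \<le> p" using assms by (meson less_imp_le of_nat_0_le_iff order_trans)
  have "integrable lebesgue (\<lambda>y. indicator (- ball x \<delta>) y * norm (y - x) powr - p)"
    "(\<integral>y. indicator (- ball x \<delta>) y * norm (y - x) powr - p \<partial>lebesgue) \<le> ?K * \<delta> powr (real DIM('a) - p)"
    if "0 < \<delta>" for x :: 'a and \<delta>
    by (rule norm_powr_integral_geometric[OF p _ that q _ cover[OF that]]; simp)+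
  moreover have "0 < ?K" using q by simp
  ultimately show thesis using that by blast
qed

lemma norm_powr_integral_ball:
  assumes "0 \<le> p" "p < real DIM('a)"
  obtains C where "0 < C"
    "\<And>(x::'a::euclidean_space) \<delta>. 0 < \<delta> \<Longrightarrow> integrable lebesgue (\<lambda>y. indicator (ball x \<delta>) y * norm (y - x) powr - p)"
    "\<And>(x::'a) \<delta>. 0 < \<delta> \<Longrightarrow> (\<integral>y. indicator (ball x \<delta>) y * norm (y - x) powr - p \<partial>lebesgue)
        \<le> C * \<delta> powr (real DIM('a) - p)"
proof -
  let ?\<rho> = "1 / 2 :: real" and ?n = "real DIM('a)"
  have q: "?\<rho> powr (?n - p) < 1" using assms powr_less_mono2[of "?n - p" "1/2" 1] by simp
  \<comment> \<open>Starting at \<open>\<delta> / 2\<close> makes the annulus of index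
    \<open>0\<close> end exactly at \<open>\<delta>\<close>. The annuli now shrink, so the least
    index is taken for the inner bound.\<close>
  have cover: "\<exists>k. (\<delta> / 2) * ?\<rho> ^ k \<le> norm (y - x) \<and> norm (y - x) < 2 * ((\<delta> / 2) * ?\<rho> ^ k)"
    if "0 < \<delta>" "y \<in> ball x \<delta>" "y \<noteq> x" for x y :: 'a and \<delta>
  proof -
    let ?P = "\<lambda>k. (\<delta> / 2) * ?\<rho> ^ k \<le> norm (y - x)"
    have "0 < norm (y - x) / (\<delta> / 2)" using that by simp
    then obtain n where "?\<rho> ^ n < norm (y - x) / (\<delta> / 2)"
      using real_arch_pow_inv[of _ ?\<rho>] by auto
    then have n: "?P n" using that by (simp add: field_simps)
    have "norm (y - x) < 2 * ((\<delta> / 2) * ?\<rho> ^ (LEAST k. ?P k))"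
    proof (cases "LEAST k. ?P k")
      case 0 then show ?thesis using that by (simp add: dist_norm norm_minus_commute)
    next
      case (Suc j)
      then have "\<not> ?P j" by (metis lessI not_less_Least)
      then show ?thesis using Suc by simp
    qed
    with LeastI[of ?P, OF n] show ?thesis by blast
  qed
  let ?K = "unit_ball_vol ?n * 2 ^ DIM('a) / (1 - ?\<rho> powr (?n - p))"
  have geo: "integrable lebesgue (\<lambda>y. indicator (ball x \<delta>) y * norm (y - x) powr - p)"
    "(\<integral>y. indicator (ball x \<delta>) y * norm (y - x) powr - p \<partial>lebesgue) \<le> ?K * (\<delta> / 2) powr (?n - p)"
    if "0 < \<delta>" for x :: 'a and \<delta>
    by (rule norm_powr_integral_geometric[OF assms(1) _ _ q _ cover[OF that]]; use that in simp)+
  show thesis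
  proof (rule that)
    show "0 < ?K" using q by simp
    show "integrable lebesgue (\<lambda>y. indicator (ball x \<delta>) y * norm (y - x) powr - p)"
      if "0 < \<delta>" for x :: 'a and \<delta>
      by (rule geo(1)[OF that])
    show "(\<integral>y. indicator (ball x \<delta>) y * norm (y - x) powr - p \<partial>lebesgue) \<le> ?K * \<delta> powr (?n - p)"
      if "0 < \<delta>" for x :: 'a and \<delta>
    proof (rule order_trans[OF geo(2)[OF that]])
      have "(\<delta> / 2) powr (?n - p) \<le> \<delta> powr (?n - p)" using assms that by (intro powr_mono2) auto
      then show "?K * (\<delta> / 2) powr (?n - p) \<le> ?K * \<delta> powr (?n - p)"
        using q by (intro mult_left_mono) auto
    qed
  qed
qed

section \<open>Point reflection and the second-order Taylor estimate\<close>

lemma lebesgue_integral_odd_eq_0: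
  fixes f :: "'a::euclidean_space \<Rightarrow> real"
  assumes [measurable]: "f \<in> borel_measurable borel" and odd: "\<And>y. f (2 *\<^sub>R x - y) = - f y"
  shows "integral\<^sup>L lebesgue f = 0"
proof -
  have "integral\<^sup>L lebesgue f = integral\<^sup>L lborel f" by (intro integral_completion) measurable
  \<comment> \<open>The point reflection through \<open>x\<close> is affine with factor
    \<open>-1\<close>, so it preserves Lebesgue measure and the integral equals its own
    negative.\<close>
  also have "\<dots> = integral\<^sup>L (distr lborel borel (\<lambda>y. 2 *\<^sub>R x - y)) f"
    by (subst lborel_affine[of "-1" "2 *\<^sub>R x"]) (simp_all add: density_1)
  also have "\<dots> = (\<integral>y. f (2 *\<^sub>R x - y) \<partial>lborel)" by (intro integral_distr) measurable
  also have "\<dots> = - integral\<^sup>L lborel f" by (simp add: odd)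
  also have "integral\<^sup>L lborel f = integral\<^sup>L lebesgue f"
    by (intro integral_completion[symmetric]) measurable
  finally show ?thesis by simp
qed

text \<open>The mean value theorem on the segment from \<open>x\<close> to \<open>y\<close> produces
  the gradient at an intermediate point; the Lipschitz bound replaces it by \<open>g x\<close> at
  the cost of \<open>L * norm (y - x)\<close>.\<close>

lemma C11_loc_taylor:
  assumes "open D" "u \<in> C11_loc D" "x \<in> D"
  obtains \<delta> L b where "0 < \<delta>" "ball x \<delta> \<subseteq> D" "0 \<le> L"
    "\<And>y. y \<in> ball x \<delta> \<Longrightarrow> \<bar>u y - u x - (y - x) \<bullet> b\<bar> \<le> L * (norm (y - x))\<^sup>2"
proof -
  from assms obtain g where g: "\<And>x. x \<in> D \<Longrightarrow> GDERIV u x :> g x"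
    "\<And>x. x \<in> D \<Longrightarrow> \<exists>e>0. \<exists>L. L-lipschitz_on (ball x e \<inter> D) g"
    unfolding C11_loc_def by blast
  obtain e L where e: "0 < e" "L-lipschitz_on (ball x e \<inter> D) g" using g assms by blast
  obtain d where d: "0 < d" "ball x d \<subseteq> D" using assms open_contains_ball by blast
  define \<delta> where "\<delta> = min d e"
  have sub: "ball x \<delta> \<subseteq> ball x e \<inter> D" using d unfolding \<delta>_def by (auto simp: subset_iff)
  have L: "0 \<le> L" using e(2) lipschitz_on_nonneg by blast
  show thesis
  proof (rule that[of \<delta> L "g x"])
    show "0 < \<delta>" using d e unfolding \<delta>_def by simp
    show "ball x \<delta> \<subseteq> D" using sub by blast
    fix y assume y: "y \<in> ball x \<delta>"
    define \<gamma> where "\<gamma> t = x + t *\<^sub>R (y - x)" for t :: real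
    have \<gamma>: "\<gamma> t \<in> ball x \<delta>" if "t \<in> {0..1}" for t
    proof -
      have "norm (t *\<^sub>R (y - x)) \<le> 1 * norm (y - x)"
        unfolding norm_scaleR using that by (intro mult_right_mono) auto
      then show ?thesis using y unfolding \<gamma>_def by (simp add: dist_norm norm_minus_commute)
    qed
    have "\<exists>t\<in>{0..1}. u (\<gamma> 1) - u (\<gamma> 0) = (1 - 0) *\<^sub>R (y - x) \<bullet> g (\<gamma> t)"
    proof (rule mvt_very_simple[of 0 1 "\<lambda>t. u (\<gamma> t)" "\<lambda>t h. (h *\<^sub>R (y - x)) \<bullet> g (\<gamma> t)"])
      fix t :: real assume "0 \<le> t" "t \<le> 1"
      then have "FDERIV u (\<gamma> t) :> (\<lambda>h. h \<bullet> g (\<gamma> t))"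
        using g(1)[of "\<gamma> t"] \<gamma>[of t] sub unfolding gderiv_def by auto
      moreover have "(\<gamma> has_derivative (\<lambda>h. h *\<^sub>R (y - x))) (at t within {0..1})"
        unfolding \<gamma>_def by (auto intro!: derivative_eq_intros)
      ultimately show "((\<lambda>t. u (\<gamma> t)) has_derivative (\<lambda>h. (h *\<^sub>R (y - x)) \<bullet> g (\<gamma> t))) (at t within {0..1})"
        using has_derivative_compose by blast
    qed simp
    then obtain t where t: "t \<in> {0..1}" "u y - u x = (y - x) \<bullet> g (\<gamma> t)"
      by (auto simp: \<gamma>_def)
    have xs: "x \<in> ball x e \<inter> D" using assms e by simp
    have "dist (g (\<gamma> t)) (g x) \<le> L * dist (\<gamma> t) x"
      using e(2) xs \<gamma>[OF t(1)] sub by (intro lipschitz_onD) auto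
    also have "dist (\<gamma> t) x \<le> norm (y - x)"
      unfolding \<gamma>_def dist_norm using t mult_right_mono[of t 1 "norm (y - x)"] by simp
    finally have lip: "norm (g (\<gamma> t) - g x) \<le> L * norm (y - x)" using L by (simp add: dist_norm mult_left_mono)
    have "\<bar>u y - u x - (y - x) \<bullet> g x\<bar> = \<bar>(y - x) \<bullet> (g (\<gamma> t) - g x)\<bar>"
      using t by (simp add: inner_diff_right)
    also have "\<dots> \<le> norm (y - x) * norm (g (\<gamma> t) - g x)" by (rule Cauchy_Schwarz_ineq2)
    also have "\<dots> \<le> norm (y - x) * (L * norm (y - x))" using lip by (intro mult_left_mono) auto
    finally show "\<bar>u y - u x - (y - x) \<bullet> g x\<bar> \<le> L * (norm (y - x))\<^sup>2"
      by (simp add: power2_eq_square mult_ac)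
  qed (use L in auto)
qed

section \<open>Norm bounds for elliptic matrices and their inverses\<close>

lemma elliptic_matrices_norm_mult_le:
  fixes A :: "real ^ 'n ^ 'n"
  assumes "A \<in> elliptic_matrices \<theta> \<Theta>" "0 < \<theta>"
  shows "norm (A *v v) \<le> \<Theta> * norm v"
proof -
  let ?w = "A *v v"
  have A_sym: "x \<bullet> (A *v y) = y \<bullet> (A *v x)" for x y
    using assms dot_lmul_matrix[of x A y] transpose_matrix_vector[of A x]
    unfolding elliptic_matrices_def by (simp add: inner_commute)
  have pos: "0 \<le> x \<bullet> (A *v x)" and up: "x \<bullet> (A *v x) \<le> \<Theta> * (x \<bullet> x)" for x
  proof -
    have "0 \<le> \<theta> * (x \<bullet> x)" using assms by simp
    also have "\<dots> \<le> x \<bullet> (A *v x)" using assms unfolding elliptic_matrices_def by blast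
    finally show "0 \<le> x \<bullet> (A *v x)" .
    show "x \<bullet> (A *v x) \<le> \<Theta> * (x \<bullet> x)" using assms unfolding elliptic_matrices_def by blast
  qed
  have T: "0 \<le> \<Theta>"
  proof -
    have "0 \<le> \<Theta> * ((axis undefined 1 :: real ^ 'n) \<bullet> axis undefined 1)"
      using pos up order_trans by blast
    then show ?thesis by (simp add: inner_axis_axis)
  qed
  have pol: "4 * (x \<bullet> (A *v y)) \<le> \<Theta> * ((x + y) \<bullet> (x + y))" for x y
  proof -
    have "4 * (x \<bullet> (A *v y)) = (x + y) \<bullet> (A *v (x + y)) - (x - y) \<bullet> (A *v (x - y))"
      using A_sym[of x y]
      by (simp add: matrix_vector_right_distrib matrix_vector_mult_diff_distrib inner_add_left inner_add_right inner_diff_left inner_diff_right)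
    also have "\<dots> \<le> \<Theta> * ((x + y) \<bullet> (x + y))" using pos[of "x - y"] up[of "x + y"] by linarith
    finally show ?thesis .
  qed
  show ?thesis
  proof (cases "?w = 0 \<or> v = 0")
    case True
    then show ?thesis using T by auto
  next
    case False
    \<comment> \<open>Rescaling \<open>A *v v\<close> to the length of \<open>v\<close> turns the
      bilinear form into \<open>norm v * norm ?w\<close>, while
      \<open>norm (x + v) \<le> 2 * norm v\<close> cancels the factor \<open>4\<close> of
      polarization.\<close>
    define x where "x = (norm v / norm ?w) *\<^sub>R ?w"
    have nx: "norm x = norm v" using False by (simp add: x_def)
    have xw: "x \<bullet> ?w = norm v * norm ?w"
      using False by (simp add: x_def dot_square_norm power2_eq_square)
    have "4 * (norm v * norm ?w) \<le> \<Theta> * (norm (x + v))\<^sup>2"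
      using pol[of x v] by (simp only: xw dot_square_norm)
    also have "\<dots> \<le> \<Theta> * (2 * norm v)\<^sup>2"
      using norm_triangle_ineq[of x v] nx by (intro mult_left_mono power_mono T) auto
    finally have "norm v * norm ?w \<le> norm v * (\<Theta> * norm v)" by (simp add: power2_eq_square mult_ac)
    then show ?thesis using False by simp
  qed
qed

text \<open>Positivity of the form makes \<open>A\<close> injective, hence invertible, and the
  previous bound is applied to \<open>matrix_inv A *v v\<close>. This dominates all admissible
  kernels by one multiple of \<open>norm z powr - p\<close>.\<close>

lemma elliptic_matrices_norm_inv_ge:
  fixes A :: "real ^ 'n ^ 'n"
  assumes "A \<in> elliptic_matrices \<theta> \<Theta>" "0 < \<theta>"
  shows "norm v \<le> \<Theta> * norm (matrix_inv A *v v)"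
proof -
  have "inj ((*v) A)"
  proof (rule injI)
    fix x y assume "A *v x = A *v y"
    then have "(x - y) \<bullet> (A *v (x - y)) = 0" by (simp add: matrix_vector_mult_diff_distrib)
    moreover have "\<theta> * ((x - y) \<bullet> (x - y)) \<le> (x - y) \<bullet> (A *v (x - y))"
      using assms unfolding elliptic_matrices_def by blast
    ultimately have "\<theta> * ((x - y) \<bullet> (x - y)) \<le> 0" by simp
    then have "(x - y) \<bullet> (x - y) \<le> 0" using assms(2) by (simp add: mult_le_0_iff)
    then show "x = y" by (metis antisym inner_eq_zero_iff inner_ge_zero right_minus_eq)
  qed
  then have "invertible A"
    using invertible_left_inverse matrix_left_invertible_injective[of A] by auto
  then have "A ** matrix_inv A = mat 1"
    unfolding matrix_inv_def invertible_def by (rule someI2_ex) simp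
  then have "v = A *v (matrix_inv A *v v)" by (simp add: matrix_vector_mul_assoc)
  then show ?thesis using elliptic_matrices_norm_mult_le[OF assms] by metis
qed

lemma scaleR_mat_elliptic:
  assumes "\<theta> \<le> \<Theta>"
  shows "\<theta> *\<^sub>R mat 1 \<in> (elliptic_matrices \<theta> \<Theta> :: (real ^ 'n ^ 'n) set)"
  using assms unfolding elliptic_matrices_def
  by (auto simp: transpose_scalar transpose_mat scaleR_matrix_vector_assoc[symmetric] mult_right_mono)

lemma matrix_inv_scaleR_mat:
  assumes "0 < \<theta>"
  shows "matrix_inv (\<theta> *\<^sub>R mat 1 :: real ^ 'n ^ 'n) *v v = (1 / \<theta>) *\<^sub>R v"
proof -
  let ?A = "\<theta> *\<^sub>R mat 1 :: real ^ 'n ^ 'n"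
  have "?A ** ((1 / \<theta>) *\<^sub>R mat 1) = mat 1 \<and> ((1 / \<theta>) *\<^sub>R mat 1) ** ?A = mat 1"
    using assms by (simp add: matrix_scalar_ac scalar_matrix_assoc flip: scalar_matrix_assoc)
  \<comment> \<open>\<open>matrix_inv\<close> chooses some two-sided inverse, so it is a genuine
    inverse once one has been exhibited.\<close>
  then have "matrix_inv ?A ** ?A = mat 1"
    unfolding matrix_inv_def by (rule someI2) simp
  then have "matrix_inv ?A *v (?A *v w) = w" for w by (simp add: matrix_vector_mul_assoc)
  from this[of "(1 / \<theta>) *\<^sub>R v"] show ?thesis
    using assms by (simp add: scaleR_matrix_vector_assoc[symmetric])
qed

section \<open>Principal values and comparison with the fractional Laplacian\<close>

lemma continuous_on_C11_loc: "u \<in> C11_loc D \<Longrightarrow> continuous_on D u"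
  unfolding C11_loc_def gderiv_def
  by (auto intro!: continuous_at_imp_continuous_on dest: has_derivative_continuous)

text \<open>Off \<open>ball x e\<close> the linear term is bounded by a constant times the
  integrable tail of the kernel; since the kernel is even, reflection through \<open>x\<close> flips
  the sign of the product.\<close>

lemma annulus_linear_kernel:
  fixes k :: "'a::euclidean_space \<Rightarrow> real"
  assumes k[measurable]: "k \<in> borel_measurable borel" and even: "\<And>z. k (- z) = k z" and nonneg: "\<And>z. 0 \<le> k z"
    and le: "\<And>z. k z \<le> B * norm z powr - p" and p: "real DIM('a) < p" and "0 < e"
  shows "integrable lebesgue (\<lambda>y. indicator (- ball x e) y * (indicator (ball x \<delta>) y * ((y - x) \<bullet> b) * k (y - x)))"
    and "(\<integral>y. indicator (- ball x e) y * (indicator (ball x \<delta>) y * ((y - x) \<bullet> b) * k (y - x)) \<partial>lebesgue) = 0"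
proof -
  let ?f = "\<lambda>y. indicator (- ball x e) y * (indicator (ball x \<delta>) y * ((y - x) \<bullet> b) * k (y - x)) :: real"
  have [measurable]: "ball x e' \<in> sets borel" for e' by simp
  have f: "?f \<in> borel_measurable borel" by measurable
  obtain C where "\<And>(x::'a) \<delta>. 0 < \<delta> \<Longrightarrow> integrable lebesgue (\<lambda>y. indicator (- ball x \<delta>) y * norm (y - x) powr - p)"
    using norm_powr_integral_outside_ball[OF p] by metis
  then have g: "integrable lebesgue (\<lambda>y. \<delta> * norm b * B * (indicator (- ball x e) y * norm (y - x) powr - p))"
    using \<open>0 < e\<close> by (intro integrable_mult_right)
  show "integrable lebesgue ?f"
  proof (rule Bochner_Integration.integrable_bound[OF g])
    show "?f \<in> borel_measurable lebesgue" using f by (simp add: measurable_completion)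
    show "AE y in lebesgue. norm (?f y) \<le> norm (\<delta> * norm b * B * (indicator (- ball x e) y * norm (y - x) powr - p))"
    proof (rule AE_I2)
      fix y
      show "norm (?f y) \<le> norm (\<delta> * norm b * B * (indicator (- ball x e) y * norm (y - x) powr - p))"
      proof (cases "y \<in> ball x \<delta> - ball x e")
        case True
        then have "norm (y - x) \<le> \<delta>" by (simp add: dist_norm norm_minus_commute)
        then have "\<bar>(y - x) \<bullet> b\<bar> \<le> \<delta> * norm b"
          using Cauchy_Schwarz_ineq2[of "y - x" b] by (meson mult_right_mono norm_ge_zero order_trans)
        moreover from this have "0 \<le> \<delta> * norm b" by linarith
        ultimately have "\<bar>(y - x) \<bullet> b\<bar> * k (y - x) \<le> (\<delta> * norm b) * (B * norm (y - x) powr - p)"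
          using le nonneg by (intro mult_mono) auto
        also have "\<dots> \<le> \<bar>\<delta> * norm b * B * norm (y - x) powr - p\<bar>" by (simp add: mult.assoc)
        finally show ?thesis using True nonneg by (simp add: abs_mult)
      qed auto
    qed
  qed
  show "integral\<^sup>L lebesgue ?f = 0"
  proof (rule lebesgue_integral_odd_eq_0[OF f])
    fix y
    have "k (x - y) = k (y - x)" using even[of "y - x"] by simp
    moreover have reflection: "2 *\<^sub>R x - y - x = x - y" by (simp add: scaleR_2)
    moreover have "dist x (2 *\<^sub>R x - y) = dist x y"
      using arg_cong[OF reflection, of norm] by (simp add: dist_norm norm_minus_commute)
    moreover have "(x - y) \<bullet> b = - ((y - x) \<bullet> b)" by (simp add: inner_diff_left)
    ultimately show "?f (2 *\<^sub>R x - y) = - ?f y"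
      unfolding reflection by (simp only: indicator_def mem_ball Compl_iff mult_minus_right mult_minus_left)
  qed
qed

text \<open>At distance at least \<open>e\<close> from \<open>x\<close>, the kernel centred at
  \<open>x\<close> is at most a constant times the weight that defines
  \<open>Ls_space\<close>.\<close>

lemma Ls_space_integrable_outside_ball:
  fixes u :: "real ^ 'n \<Rightarrow> real"
  assumes u: "u \<in> Ls_space s" and "0 < s" "0 < e"
  shows "integrable lebesgue (\<lambda>y. indicator (- ball x e) y * (\<bar>u y\<bar> * norm (y - x) powr - (real CARD('n) + 2 * s)))"
proof -
  define p where "p = real CARD('n) + 2 * s"
  have p: "0 < p" using assms by (simp add: p_def add_nonneg_pos)
  \<comment> \<open>With \<open>t = norm (y - x) \<ge> e\<close>, the first summand comes from
    \<open>1 \<le> e powr - p * t powr p\<close>, the second from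
    \<open>norm y \<le> t * (1 + norm x / e)\<close>.\<close>
  define C where "C = e powr - p + (1 + norm x / e) powr p"
  have [measurable]: "u \<in> borel_measurable lebesgue"
    and "integrable lebesgue (\<lambda>y. \<bar>u y\<bar> / (1 + norm y powr p))"
    using u unfolding Ls_space_def p_def by auto
  then have g: "integrable lebesgue (\<lambda>y. C * (\<bar>u y\<bar> / (1 + norm y powr p)))"
    by (intro integrable_mult_right)
  have "integrable lebesgue (\<lambda>y. indicator (- ball x e) y * (\<bar>u y\<bar> * norm (y - x) powr - p))"
  proof (rule Bochner_Integration.integrable_bound[OF g])
    have "(\<lambda>y. norm (y - x) powr - p) \<in> borel_measurable borel" by measurable
    then have [measurable]: "(\<lambda>y. norm (y - x) powr - p) \<in> borel_measurable lebesgue"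
      by (simp add: measurable_completion)
    have [measurable]: "ball x e \<in> sets lebesgue" by simp
    show "(\<lambda>y. indicator (- ball x e) y * (\<bar>u y\<bar> * norm (y - x) powr - p)) \<in> borel_measurable lebesgue"
      by measurable
    show "AE y in lebesgue. norm (indicator (- ball x e) y * (\<bar>u y\<bar> * norm (y - x) powr - p))
        \<le> norm (C * (\<bar>u y\<bar> / (1 + norm y powr p)))"
    proof (rule AE_I2)
      fix y
      show "norm (indicator (- ball x e) y * (\<bar>u y\<bar> * norm (y - x) powr - p))
        \<le> norm (C * (\<bar>u y\<bar> / (1 + norm y powr p)))"
      proof (cases "y \<in> ball x e")
        case False
        define t where "t = norm (y - x)"
        have t: "e \<le> t" using False by (simp add: t_def dist_norm norm_minus_commute)
        then have "0 < t" using \<open>0 < e\<close> by simp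
        have "norm y \<le> t + norm x" unfolding t_def using norm_triangle_ineq[of "y - x" x] by simp
        also have "norm x \<le> t * (norm x / e)" using t \<open>0 < e\<close> by (simp add: pos_le_divide_eq mult_right_mono mult.commute[of _ e])
        finally have "norm y \<le> t * (1 + norm x / e)" by (simp add: algebra_simps)
        then have "norm y powr p \<le> (t * (1 + norm x / e)) powr p" using p by (intro powr_mono2) auto
        also have "\<dots> = t powr p * (1 + norm x / e) powr p"
          using \<open>0 < t\<close> \<open>0 < e\<close> by (simp add: powr_mult)
        finally have 1: "norm y powr p \<le> t powr p * (1 + norm x / e) powr p" .
        have "e powr p \<le> t powr p" using t p \<open>0 < e\<close> by (intro powr_mono2) auto
        then have "1 \<le> t powr p * e powr - p" using \<open>0 < e\<close> by (simp add: powr_minus field_simps)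
        with 1 have "1 + norm y powr p \<le> C * t powr p" unfolding C_def by (simp add: algebra_simps)
        then have "(1 + norm y powr p) * t powr - p \<le> C"
          using \<open>0 < t\<close> by (simp add: powr_minus field_simps)
        moreover have "0 < 1 + norm y powr p" by (simp add: add_pos_nonneg)
        ultimately have "t powr - p \<le> C / (1 + norm y powr p)" by (simp add: pos_le_divide_eq mult.commute)
        then have "\<bar>u y\<bar> * t powr - p \<le> \<bar>u y\<bar> * (C / (1 + norm y powr p))" by (intro mult_left_mono) auto
        also have "\<dots> \<le> norm (C * (\<bar>u y\<bar> / (1 + norm y powr p)))"
          unfolding real_norm_def by (rule order_trans[OF _ abs_ge_self]) (simp add: mult.commute)
        finally show ?thesis using False by (simp add: t_def)
      qed auto
    qed
  qed
  then show ?thesis by (simp add: p_def)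
qed

text \<open>Subtracting the linear Taylor part on a small ball, which the even kernel integrates to
  zero, leaves an absolutely convergent integral; its bound is uniform over all kernels dominated
  by the same power, hence over all elliptic matrices.\<close>

lemma principal_value_converges:
  fixes u :: "real ^ 'n \<Rightarrow> real"
  assumes n: "CARD('n) \<ge> 2" and s: "0 < s" "s < 1"
    and D: "open D" "x \<in> D" and u: "u \<in> Ls_space s" "u \<in> C11_loc D"
  defines "p \<equiv> real CARD('n) + 2 * s"
  obtains K where "\<And>k B. \<lbrakk>k \<in> borel_measurable borel; \<And>z. k (- z) = k z; \<And>z. 0 \<le> k z;
      \<And>z. k z \<le> B * norm z powr - p\<rbrakk> \<Longrightarrow>
      \<exists>l. ((\<lambda>e. LINT y:- ball x e|lebesgue. (u y - u x) * k (y - x)) \<longlongrightarrow> l) (at_right 0) \<and> \<bar>l\<bar> \<le> B * K"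
proof -
  obtain \<delta> L b where \<delta>: "0 < \<delta>" "ball x \<delta> \<subseteq> D" "0 \<le> L"
    and taylor: "\<And>y. y \<in> ball x \<delta> \<Longrightarrow> \<bar>u y - u x - (y - x) \<bullet> b\<bar> \<le> L * (norm (y - x))\<^sup>2"
    by (rule C11_loc_taylor[OF D(1) u(2) D(2)]) blast
  \<comment> \<open>Inside the ball \<open>T\<close> is the Taylor remainder, outside it is the
    plain increment; \<open>W\<close> is then the common majorant for all kernels.\<close>
  define T where "T y = u y - u x - indicator (ball x \<delta>) y * ((y - x) \<bullet> b)" for y
  define W where "W y = \<bar>T y\<bar> * norm (y - x) powr - p" for y
  have p: "real DIM(real ^ 'n) < p" "0 \<le> p - 2" "p - 2 < real DIM(real ^ 'n)"
    using n s by (auto simp: p_def)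
  have [measurable]: "u \<in> borel_measurable lebesgue" using u unfolding Ls_space_def by auto
  have "(\<lambda>y. norm (y - x) powr - p) \<in> borel_measurable borel" "(\<lambda>y. (y - x) \<bullet> b) \<in> borel_measurable borel"
    by measurable
  then have [measurable]: "(\<lambda>y. norm (y - x) powr - p) \<in> borel_measurable lebesgue"
      "(\<lambda>y. (y - x) \<bullet> b) \<in> borel_measurable lebesgue"
    by (simp_all add: measurable_completion)
  have [measurable]: "ball x e \<in> sets lebesgue" for e by simp
  have T[measurable]: "T \<in> borel_measurable lebesgue" unfolding T_def by measurable
  have far: "integrable lebesgue (\<lambda>y. indicator (- ball x e) y * norm (y - x) powr - p)" if "0 < e" for e
    by (rule norm_powr_integral_outside_ball[OF p(1)]) (use that in blast)
  have near: "integrable lebesgue (\<lambda>y. indicator (ball x \<delta>) y * norm (y - x) powr - (p - 2))"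
    by (rule norm_powr_integral_ball[OF p(2,3)]) (use \<delta>(1) in blast)
  \<comment> \<open>The quadratic remainder lowers the singularity to the exponent
    \<open>p - 2\<close>, which is below the dimension because \<open>s < 1\<close>. Away from
    \<open>x\<close>, membership in \<open>Ls_space\<close> controls \<open>u\<close> and the tail
    of the kernel controls \<open>u x\<close>.\<close>
  have W: "integrable lebesgue W"
  proof (rule Bochner_Integration.integrable_bound)
    let ?g = "\<lambda>y. L * (indicator (ball x \<delta>) y * norm (y - x) powr - (p - 2))
        + (indicator (- ball x \<delta>) y * (\<bar>u y\<bar> * norm (y - x) powr - p)
          + \<bar>u x\<bar> * (indicator (- ball x \<delta>) y * norm (y - x) powr - p))"
    show "integrable lebesgue ?g"
      using near far[OF \<delta>(1)] Ls_space_integrable_outside_ball[OF u(1) s(1) \<delta>(1), of x]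
      unfolding p_def[symmetric]
      by (intro Bochner_Integration.integrable_add integrable_mult_right)
    show "W \<in> borel_measurable lebesgue" unfolding W_def by measurable
    show "AE y in lebesgue. norm (W y) \<le> norm (?g y)"
    proof (rule AE_I2)
      fix y
      show "norm (W y) \<le> norm (?g y)"
      proof (cases "y \<in> ball x \<delta>")
        case True
        have "W y \<le> (L * (norm (y - x))\<^sup>2) * norm (y - x) powr - p"
          unfolding W_def T_def using taylor[OF True] True by (intro mult_right_mono) auto
        also have "\<dots> = L * norm (y - x) powr - (p - 2)"
          by (cases "y = x") (simp_all add: powr_add[symmetric] flip: powr_numeral)
        finally show ?thesis using True \<delta> by (simp add: W_def)
      next
        case False
        have "W y \<le> (\<bar>u y\<bar> + \<bar>u x\<bar>) * norm (y - x) powr - p"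
          unfolding W_def T_def using False by (intro mult_right_mono) auto
        then show ?thesis using False by (simp add: W_def distrib_right)
      qed
    qed
  qed
  have *: "\<exists>l. ((\<lambda>e. LINT y:- ball x e|lebesgue. (u y - u x) * k (y - x)) \<longlongrightarrow> l) (at_right 0)
        \<and> \<bar>l\<bar> \<le> B * integral\<^sup>L lebesgue W"
    if k: "k \<in> borel_measurable borel" and even: "\<And>z. k (- z) = k z" and nonneg: "\<And>z. 0 \<le> k z"
      and le: "\<And>z. k z \<le> B * norm z powr - p" for k B
  proof -
    have "(\<lambda>y. k (y - x)) \<in> borel_measurable borel" using k by measurable
    then have [measurable]: "(\<lambda>y. k (y - x)) \<in> borel_measurable lebesgue"
      by (simp add: measurable_completion)
    \<comment> \<open>The domination at \<open>0\<close> reads \<open>k 0 \<le> B * 0\<close>, as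
      \<open>0 powr - p\<close> is \<open>0\<close>. This settles pointwise convergence at
      \<open>y = x\<close>, which every truncation removes.\<close>
    have k0: "k 0 = 0" using le[of 0] nonneg[of 0] by simp
    have dom: "\<bar>T y * k (y - x)\<bar> \<le> B * W y" for y
      using mult_left_mono[OF le[of "y - x"], of "\<bar>T y\<bar>"] nonneg[of "y - x"]
      by (simp add: W_def abs_mult mult_ac)
    have BW: "integrable lebesgue (\<lambda>y. B * W y)" using W by (intro integrable_mult_right)
    have Tk: "integrable lebesgue (\<lambda>y. T y * k (y - x))"
    proof (rule Bochner_Integration.integrable_bound[OF BW])
      show "AE y in lebesgue. norm (T y * k (y - x)) \<le> norm (B * W y)"
        unfolding real_norm_def by (rule AE_I2) (rule order_trans[OF dom abs_ge_self])
    qed measurable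
    \<comment> \<open>The increment and \<open>T\<close> differ by the linear term, which has
      integral zero over every truncation.\<close>
    have trunc: "(LINT y:- ball x e|lebesgue. (u y - u x) * k (y - x))
        = (\<integral>y. indicator (- ball x e) y * (T y * k (y - x)) \<partial>lebesgue)" if "0 < e" for e
    proof -
      let ?A = "\<lambda>y. indicator (- ball x e) y * (T y * k (y - x)) :: real"
      let ?B = "\<lambda>y. indicator (- ball x e) y * (indicator (ball x \<delta>) y * ((y - x) \<bullet> b) * k (y - x)) :: real"
      note lin = annulus_linear_kernel[OF k even nonneg le p(1) that, of x \<delta> b]
      have A: "integrable lebesgue ?A"
        using integrable_mult_indicator[OF _ Tk, of "- ball x e"] by simp
      have "(LINT y:- ball x e|lebesgue. (u y - u x) * k (y - x)) = (\<integral>y. ?A y + ?B y \<partial>lebesgue)"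
        unfolding set_lebesgue_integral_def
        by (intro Bochner_Integration.integral_cong) (auto simp: T_def algebra_simps)
      also have "\<dots> = integral\<^sup>L lebesgue ?A"
        using A lin by (simp add: Bochner_Integration.integral_add)
      finally show ?thesis .
    qed
    have "((\<lambda>e. LINT y:- ball x e|lebesgue. (u y - u x) * k (y - x)) \<longlongrightarrow> (\<integral>y. T y * k (y - x) \<partial>lebesgue)) (at_right 0)"
    proof (rule tendsto_at_right_sequentially[OF \<delta>(1)])
      fix S :: "nat \<Rightarrow> real" assume S: "\<And>n. 0 < S n" "S \<longlonglongrightarrow> 0"
      have "(\<lambda>n. \<integral>y. indicator (- ball x (S n)) y * (T y * k (y - x)) \<partial>lebesgue)
          \<longlonglongrightarrow> (\<integral>y. T y * k (y - x) \<partial>lebesgue)"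
      proof (rule integral_dominated_convergence[OF _ _ BW])
        show "AE y in lebesgue. norm (indicator (- ball x (S n)) y * (T y * k (y - x))) \<le> B * W y" for n
        proof (rule AE_I2)
          fix y
          have "norm (indicator (- ball x (S n)) y * (T y * k (y - x))) \<le> \<bar>T y * k (y - x)\<bar>"
            by (simp add: indicator_def)
          then show "norm (indicator (- ball x (S n)) y * (T y * k (y - x))) \<le> B * W y"
            using dom order_trans by blast
        qed
        show "AE y in lebesgue. (\<lambda>n. indicator (- ball x (S n)) y * (T y * k (y - x))) \<longlonglongrightarrow> T y * k (y - x)"
        proof (rule AE_I2)
          fix y
          show "(\<lambda>n. indicator (- ball x (S n)) y * (T y * k (y - x))) \<longlonglongrightarrow> T y * k (y - x)"
          proof (cases "y = x")
            case False
            then have "\<forall>\<^sub>F n in sequentially. S n < dist x y"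
              using order_tendstoD(2)[OF S(2), of "dist x y"] by simp
            then have "\<forall>\<^sub>F n in sequentially. indicator (- ball x (S n)) y * (T y * k (y - x)) = T y * k (y - x)"
              by eventually_elim (simp add: indicator_def)
            then show ?thesis by (rule tendsto_eventually)
          qed (simp add: k0)
        qed
      qed measurable
      then show "(\<lambda>n. LINT y:- ball x (S n)|lebesgue. (u y - u x) * k (y - x)) \<longlonglongrightarrow> (\<integral>y. T y * k (y - x) \<partial>lebesgue)"
        using S(1) by (simp add: trunc)
    qed
    moreover have "\<bar>\<integral>y. T y * k (y - x) \<partial>lebesgue\<bar> \<le> (\<integral>y. B * W y \<partial>lebesgue)"
      by (rule order_trans[OF integral_abs_bound]) (intro integral_mono integrable_abs Tk BW dom)
    ultimately show ?thesis by auto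
  qed
  show thesis by (rule that[OF *])
qed

text \<open>This replaces the nonlinear operator by a linear one: the weak and the strong statement
  both need only an upper bound for \<open>Fs\<close>.\<close>

lemma Fs_le_scaled_fractional_laplacian:
  fixes u :: "real ^ 'n \<Rightarrow> real"
  assumes n: "CARD('n) \<ge> 2" and s: "0 < s" "s < 1" and \<theta>: "0 < \<theta>" "\<theta> \<le> \<Theta>"
    and D: "open D" "x \<in> D" and u: "u \<in> Ls_space s" "u \<in> C11_loc D"
  defines "p \<equiv> real CARD('n) + 2 * s"
  obtains l where "((\<lambda>e. LINT y:- ball x e|lebesgue. (u y - u x) * norm (y - x) powr - p) \<longlongrightarrow> l) (at_right 0)"
    "Fs s \<theta> \<Theta> u x \<le> \<theta> powr p * l"
proof -
  obtain K where K: "\<And>k B. \<lbrakk>k \<in> borel_measurable borel; \<And>z. k (- z) = k z; \<And>z. 0 \<le> k z;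
      \<And>z. k z \<le> B * norm z powr - p\<rbrakk> \<Longrightarrow>
      \<exists>l. ((\<lambda>e. LINT y:- ball x e|lebesgue. (u y - u x) * k (y - x)) \<longlongrightarrow> l) (at_right 0) \<and> \<bar>l\<bar> \<le> B * K"
    by (rule principal_value_converges[OF n s D u, folded p_def]) blast
  define F where "F A y = (u y - u x) / norm (matrix_inv A *v (y - x)) powr p" for A :: "real ^ 'n ^ 'n" and y
  have p: "0 < p" using s by (simp add: p_def add_nonneg_pos)
  have pv_bound: "\<bar>principal_value (F A) x\<bar> \<le> \<Theta> powr p * K" if A: "A \<in> elliptic_matrices \<theta> \<Theta>" for A
  proof -
    let ?k = "\<lambda>z. 1 / norm (matrix_inv A *v z) powr p"
    have "\<exists>l. ((\<lambda>e. LINT y:- ball x e|lebesgue. (u y - u x) * ?k (y - x)) \<longlongrightarrow> l) (at_right 0)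
        \<and> \<bar>l\<bar> \<le> \<Theta> powr p * K"
    proof (rule K)
      have [measurable]: "(\<lambda>z. matrix_inv A *v z) \<in> borel_measurable borel"
        by (intro borel_measurable_continuous_onI linear_continuous_on matrix_vector_mul_bounded_linear)
      show "?k \<in> borel_measurable borel" by measurable
      fix z :: "real ^ 'n"
      show "?k (- z) = ?k z" using matrix_vector_mult_diff_distrib[of "matrix_inv A" 0 z] by simp
      show "0 \<le> ?k z" by simp
      show "?k z \<le> \<Theta> powr p * norm z powr - p"
      proof (cases "z = 0")
        case False
        have ge: "norm z \<le> \<Theta> * norm (matrix_inv A *v z)"
          by (rule elliptic_matrices_norm_inv_ge[OF A \<theta>(1)])
        then have 0: "matrix_inv A *v z \<noteq> 0" using False by auto
        have "norm z powr p \<le> (\<Theta> * norm (matrix_inv A *v z)) powr p"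
          using ge p by (intro powr_mono2) auto
        then have "norm z powr p \<le> \<Theta> powr p * norm (matrix_inv A *v z) powr p"
          using \<theta> by (simp add: powr_mult)
        then show ?thesis using False 0 by (simp add: powr_minus field_simps)
      qed simp
    qed
    then obtain l where l: "((\<lambda>e. LINT y:- ball x e|lebesgue. F A y) \<longlongrightarrow> l) (at_right 0)" "\<bar>l\<bar> \<le> \<Theta> powr p * K"
      unfolding F_def by auto
    then show ?thesis unfolding principal_value_def by (simp add: tendsto_Lim)
  qed
  \<comment> \<open>A real infimum is known to lie below its members only when the set is bounded
    below; the bound \<open>\<Theta> powr p * K\<close> is uniform in \<open>A\<close>.\<close>
  have "bdd_below ((\<lambda>A. principal_value (F A) x) ` elliptic_matrices \<theta> \<Theta>)"
    using pv_bound by (intro bdd_belowI2[of _ "- (\<Theta> powr p * K)"]) (auto simp: abs_le_iff minus_le_iff)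
  then have Fs: "Fs s \<theta> \<Theta> u x \<le> principal_value (F (\<theta> *\<^sub>R mat 1)) x"
    unfolding Fs_def F_def p_def by (intro cINF_lower scaleR_mat_elliptic \<theta>)
  obtain l where l: "((\<lambda>e. LINT y:- ball x e|lebesgue. (u y - u x) * norm (y - x) powr - p) \<longlongrightarrow> l) (at_right 0)"
    using K[of "\<lambda>z. norm z powr - p" 1] by auto
  have "F (\<theta> *\<^sub>R mat 1) y = \<theta> powr p * ((u y - u x) * norm (y - x) powr - p)" for y
  proof -
    have n_inv: "norm (matrix_inv (\<theta> *\<^sub>R mat 1) *v (y - x)) = norm (y - x) / \<theta>"
      unfolding matrix_inv_scaleR_mat[OF \<theta>(1)] norm_scaleR using \<theta> by simp
    show ?thesis unfolding F_def n_inv using \<theta> by (simp add: powr_divide powr_minus field_simps)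
  qed
  then have "(LINT y:- ball x e|lebesgue. F (\<theta> *\<^sub>R mat 1) y)
      = \<theta> powr p * (LINT y:- ball x e|lebesgue. (u y - u x) * norm (y - x) powr - p)" for e
    by (simp add: set_integral_mult_right)
  then have "((\<lambda>e. LINT y:- ball x e|lebesgue. F (\<theta> *\<^sub>R mat 1) y) \<longlongrightarrow> \<theta> powr p * l) (at_right 0)"
    using l by (simp add: tendsto_mult_left)
  then have "principal_value (F (\<theta> *\<^sub>R mat 1)) x = \<theta> powr p * l"
    unfolding principal_value_def by (simp add: tendsto_Lim)
  with Fs l that show thesis by simp
qed

section \<open>The penalized maximum and the integral estimate there\<close>

text \<open>The penalized function \<open>w\<close> exceeds \<open>M\<close> at \<open>x0\<close>,
  but is at most \<open>M\<close> from radius \<open>r / 2\<close> on, where the paraboloid is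
  nonpositive. So its maximum over the compact ball is global and interior; the last conclusion is
  \<open>w y \<le> w x\<close> rearranged.\<close>

lemma penalized_maximum:
  fixes u :: "'a::euclidean_space \<Rightarrow> real"
  assumes "0 < r" and cont: "continuous_on (cball x0 (r / 2)) u" and le: "\<And>y. u y \<le> M"
    and M: "0 < M" "0 < \<epsilon>" and x0: "(1 - \<epsilon>) * M < u x0"
  obtains x where "dist x0 x < r / 2" "(1 - \<epsilon>) * M \<le> u x"
    "\<And>y. u y - u x \<le> \<epsilon> * M * (4 / r\<^sup>2) * ((dist x0 y)\<^sup>2 - (dist x0 x)\<^sup>2)"
proof -
  define w where "w y = u y + \<epsilon> * M * (1 - 4 / r\<^sup>2 * (dist x0 y)\<^sup>2)" for y
  have eM: "0 < \<epsilon> * M" using M by simp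
  have "\<exists>x\<in>cball x0 (r / 2). \<forall>y\<in>cball x0 (r / 2). w y \<le> w x"
    unfolding w_def using \<open>0 < r\<close> by (intro continuous_attains_sup) (auto intro!: continuous_intros cont)
  then obtain x where x: "x \<in> cball x0 (r / 2)" and max: "\<And>y. y \<in> cball x0 (r / 2) \<Longrightarrow> w y \<le> w x" by blast
  have "M < w x0" unfolding w_def using x0 by (simp add: algebra_simps)
  also have "w x0 \<le> w x" using max \<open>0 < r\<close> by simp
  finally have big: "M < w x" .
  have out: "w y \<le> M" if "r / 2 \<le> dist x0 y" for y
  proof -
    have "(r / 2)\<^sup>2 \<le> (dist x0 y)\<^sup>2" using that \<open>0 < r\<close> by (intro power_mono) auto
    then have "1 - 4 / r\<^sup>2 * (dist x0 y)\<^sup>2 \<le> 0" using \<open>0 < r\<close> by (simp add: field_simps)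
    then have "\<epsilon> * M * (1 - 4 / r\<^sup>2 * (dist x0 y)\<^sup>2) \<le> 0" using eM by (intro mult_nonneg_nonpos) auto
    then show ?thesis using le[of y] unfolding w_def by linarith
  qed
  have max': "w y \<le> w x" for y
    using max[of y] out[of y] big by (cases "dist x0 y \<le> r / 2") auto
  show thesis
  proof (rule that)
    show "dist x0 x < r / 2" using out[of x] big by (meson not_le)
    have "\<epsilon> * M * (1 - 4 / r\<^sup>2 * (dist x0 x)\<^sup>2) \<le> \<epsilon> * M * 1" using eM by (intro mult_left_mono) auto
    then show "(1 - \<epsilon>) * M \<le> u x" using big unfolding w_def by (simp add: algebra_simps)
    show "u y - u x \<le> \<epsilon> * M * (4 / r\<^sup>2) * ((dist x0 y)\<^sup>2 - (dist x0 x)\<^sup>2)" for y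
      using max'[of y] unfolding w_def by (simp add: algebra_simps)
  qed
qed

text \<open>The integral is split at radius \<open>r / 2\<close>. Inside, the penalization bounds
  the increment by a quadratic term plus a linear one that integrates to zero; outside, the
  increment is at most \<open>\<epsilon> * M\<close>, and on \<open>G\<close> there is an additional
  \<open>- M\<close> against a kernel of at least \<open>((c1 + 1) * r) powr - p\<close>.\<close>

lemma truncated_integral_at_penalized_maximum:
  fixes u :: "real ^ 'n \<Rightarrow> real"
  assumes n: "CARD('n) \<ge> 2" and s: "0 < s" "s < 1" and c1: "1 < c1"
  defines "p \<equiv> real CARD('n) + 2 * s"
  obtains \<kappa> where "0 < \<kappa>"
    "\<And>u :: real ^ 'n \<Rightarrow> real. \<And>x x0 r M \<epsilon> G e.
      \<lbrakk>u \<in> Ls_space s; 0 < M; 0 < \<epsilon>; 0 < e; e < r / 2;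
       \<And>y. u y - u x \<le> \<epsilon> * M * (4 / r\<^sup>2) * ((dist x0 y)\<^sup>2 - (dist x0 x)\<^sup>2);
       \<And>y. u y - u x \<le> \<epsilon> * M; G \<in> lmeasurable; m * r ^ CARD('n) \<le> measure lebesgue G;
       \<And>y. y \<in> G \<Longrightarrow> u y - u x \<le> \<epsilon> * M - M \<and> r / 2 \<le> norm (y - x) \<and> norm (y - x) \<le> (c1 + 1) * r\<rbrakk>
      \<Longrightarrow> (LINT y:- ball x e|lebesgue. (u y - u x) * norm (y - x) powr - p)
        \<le> M * r powr (- 2 * s) * (\<epsilon> * \<kappa> - m * (c1 + 1) powr - p)"
proof -
  have p: "real DIM(real ^ 'n) < p" "0 \<le> p - 2" "p - 2 < real DIM(real ^ 'n)" "0 < p"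
    using n s by (auto simp: p_def)
  obtain Co where Co: "0 < Co"
    "\<And>(x :: real ^ 'n) \<delta>. 0 < \<delta> \<Longrightarrow> integrable lebesgue (\<lambda>y. indicator (- ball x \<delta>) y * norm (y - x) powr - p)"
    "\<And>(x :: real ^ 'n) \<delta>. 0 < \<delta> \<Longrightarrow> (\<integral>y. indicator (- ball x \<delta>) y * norm (y - x) powr - p \<partial>lebesgue)
        \<le> Co * \<delta> powr (real DIM(real ^ 'n) - p)"
    by (rule norm_powr_integral_outside_ball[OF p(1)]) blast
  obtain Ci where Ci: "0 < Ci"
    "\<And>(x :: real ^ 'n) \<delta>. 0 < \<delta> \<Longrightarrow> integrable lebesgue (\<lambda>y. indicator (ball x \<delta>) y * norm (y - x) powr - (p - 2))"
    "\<And>(x :: real ^ 'n) \<delta>. 0 < \<delta> \<Longrightarrow> (\<integral>y. indicator (ball x \<delta>) y * norm (y - x) powr - (p - 2) \<partial>lebesgue)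
        \<le> Ci * \<delta> powr (real DIM(real ^ 'n) - (p - 2))"
    by (rule norm_powr_integral_ball[OF p(2,3)]) blast
  \<comment> \<open>The summands come from the quadratic part, with the \<open>4\<close> of
    \<open>4 / r\<^sup>2\<close>, and from the tail; the powers of \<open>1 / 2\<close> reflect the
    splitting radius \<open>r / 2\<close>.\<close>
  define \<kappa> where "\<kappa> = 4 * Ci * (1 / 2) powr (2 - 2 * s) + Co * (1 / 2) powr (- 2 * s)"
  have "0 < \<kappa>" unfolding \<kappa>_def using Co(1) Ci(1) by (intro add_pos_pos mult_pos_pos) auto
  moreover have "(LINT y:- ball x e|lebesgue. (u y - u x) * norm (y - x) powr - p)
        \<le> M * r powr (- 2 * s) * (\<epsilon> * \<kappa> - m * (c1 + 1) powr - p)"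
    if u: "u \<in> Ls_space s" and M: "0 < M" and \<epsilon>: "0 < \<epsilon>" and e: "0 < e" "e < r / 2"
      and pen: "\<And>y. u y - u x \<le> \<epsilon> * M * (4 / r\<^sup>2) * ((dist x0 y)\<^sup>2 - (dist x0 x)\<^sup>2)"
      and max: "\<And>y. u y - u x \<le> \<epsilon> * M"
      and G: "G \<in> lmeasurable" "m * r ^ CARD('n) \<le> measure lebesgue G"
      and inG: "\<And>y. y \<in> G \<Longrightarrow> u y - u x \<le> \<epsilon> * M - M \<and> r / 2 \<le> norm (y - x) \<and> norm (y - x) \<le> (c1 + 1) * r"
    for u :: "real ^ 'n \<Rightarrow> real" and x x0 r M \<epsilon> G e
  proof -
    have r: "0 < r" using e by simp
    let ?k = "\<lambda>y. norm (y - x) powr - p"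
    let ?lin = "\<lambda>y. indicator (- ball x e) y * (indicator (ball x (r / 2)) y * ((y - x) \<bullet> (x - x0)) * ?k y) :: real"
    let ?near = "\<lambda>y. indicator (ball x (r / 2)) y * norm (y - x) powr - (p - 2) :: real"
    let ?far = "\<lambda>y. indicator (- ball x (r / 2)) y * ?k y :: real"
    let ?q = "((c1 + 1) * r) powr - p"
    define a where "a = \<epsilon> * M * (4 / r\<^sup>2)"
    \<comment> \<open>Integrable majorant of the truncated integrand; the coefficient
      \<open>2 * a\<close> is the cross term in the expansion of the squared distance to
      \<open>x0\<close> about \<open>x\<close>.\<close>
    let ?g = "\<lambda>y. a * ?near y + 2 * a * ?lin y + \<epsilon> * M * ?far y - M * ?q * indicator G y :: real"
    have a: "0 \<le> a" using M \<epsilon> by (simp add: a_def)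
    have r2: "0 < r / 2" using r by simp
    have kmeas: "(\<lambda>z :: real ^ 'n. norm z powr - p) \<in> borel_measurable borel" by measurable
    have lin: "integrable lebesgue ?lin" "integral\<^sup>L lebesgue ?lin = 0"
      by (rule annulus_linear_kernel[OF kmeas, where B = 1]; use p(1) e in simp)+
    have Gint: "integrable lebesgue (indicator G :: _ \<Rightarrow> real)"
      using G by (intro integrable_real_indicator) (auto simp: fmeasurable_def)
    note ints = Ci(2)[OF r2, of x] lin(1) Co(2)[OF r2, of x] Gint
    have gint: "integrable lebesgue ?g"
      by (intro Bochner_Integration.integrable_add Bochner_Integration.integrable_diff integrable_mult_right ints)
    have fint: "integrable lebesgue (\<lambda>y. indicator (- ball x e) y *\<^sub>R ((u y - u x) * ?k y))"
    proof -
      let ?h = "\<lambda>y. indicator (- ball x e) y * (\<bar>u y\<bar> * ?k y) + \<bar>u x\<bar> * (indicator (- ball x e) y * ?k y)"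
      have h: "integrable lebesgue ?h"
        using Ls_space_integrable_outside_ball[OF u s(1) e(1), of x] Co(2)[OF e(1), of x]
        unfolding p_def[symmetric] by (intro Bochner_Integration.integrable_add integrable_mult_right)
      have [measurable]: "u \<in> borel_measurable lebesgue" using u unfolding Ls_space_def by auto
      have [measurable]: "ball x e \<in> sets lebesgue" by simp
      have "?k \<in> borel_measurable borel" by measurable
      then have [measurable]: "?k \<in> borel_measurable lebesgue" by (simp add: measurable_completion)
      show ?thesis
      proof (rule Bochner_Integration.integrable_bound[OF h])
        show "(\<lambda>y. indicator (- ball x e) y *\<^sub>R ((u y - u x) * ?k y)) \<in> borel_measurable lebesgue" by measurable
        show "AE y in lebesgue. norm (indicator (- ball x e) y *\<^sub>R ((u y - u x) * ?k y)) \<le> norm (?h y)"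
        proof (rule AE_I2)
          fix y
          have "\<bar>u y - u x\<bar> * ?k y \<le> (\<bar>u y\<bar> + \<bar>u x\<bar>) * ?k y" by (intro mult_right_mono) auto
          then show "norm (indicator (- ball x e) y *\<^sub>R ((u y - u x) * ?k y)) \<le> norm (?h y)"
            by (simp add: indicator_def abs_mult distrib_right)
        qed
      qed
    qed
    have "(LINT y:- ball x e|lebesgue. (u y - u x) * ?k y) \<le> integral\<^sup>L lebesgue ?g"
      unfolding set_lebesgue_integral_def
    proof (rule integral_mono[OF fint gint])
      fix y
      have k: "0 \<le> ?k y" by simp
      show "indicator (- ball x e) y *\<^sub>R ((u y - u x) * ?k y) \<le> ?g y"
      proof (cases "y \<in> ball x (r / 2)")
        case True
        \<comment> \<open>\<open>G\<close> lies at distance at least \<open>r / 2\<close> from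
          \<open>x\<close>, so its gain does not enter the near part.\<close>
        have "y \<notin> G" using True inG[of y] by (force simp: dist_norm norm_minus_commute)
        show ?thesis
        proof (cases "y \<in> ball x e")
          case False
          have "(norm (v + w))\<^sup>2 = (norm v)\<^sup>2 + 2 * (v \<bullet> w) + (norm w)\<^sup>2" for v w :: "real ^ 'n"
            unfolding power2_norm_eq_inner inner_add_left inner_add_right by (simp add: inner_commute)
          from this[of "y - x" "x - x0"] have "(norm (y - x0))\<^sup>2 = (norm (y - x))\<^sup>2 + 2 * ((y - x) \<bullet> (x - x0)) + (norm (x - x0))\<^sup>2" by simp
          then have expand: "(dist x0 y)\<^sup>2 - (dist x0 x)\<^sup>2 = (norm (y - x))\<^sup>2 + 2 * ((y - x) \<bullet> (x - x0))"
            by (simp add: dist_norm norm_minus_commute)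
          have "(u y - u x) * ?k y \<le> (a * ((norm (y - x))\<^sup>2 + 2 * ((y - x) \<bullet> (x - x0)))) * ?k y"
            using pen[of y] k unfolding expand a_def by (intro mult_right_mono) auto
          also have "\<dots> = a * ((norm (y - x))\<^sup>2 * ?k y) + 2 * a * (((y - x) \<bullet> (x - x0)) * ?k y)"
            by (simp add: algebra_simps)
          also have "(norm (y - x))\<^sup>2 * ?k y = norm (y - x) powr - (p - 2)"
            by (cases "y = x") (simp_all add: powr_add[symmetric] flip: powr_numeral)
          finally show ?thesis using True False \<open>y \<notin> G\<close> by simp
        next
          case inner: True
          have "0 \<le> a * norm (y - x) powr - (p - 2)" using a by simp
          then show ?thesis using True inner \<open>y \<notin> G\<close> by simp
        qed
      next
        case False
        then have out: "y \<notin> ball x e" using e by auto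
        have "(u y - u x) * ?k y \<le> \<epsilon> * M * ?k y - M * ?q * indicator G y"
        proof (cases "y \<in> G")
          case True
          have "0 < norm (y - x)" using inG[OF True] r2 by linarith
          then have "?q \<le> ?k y" using inG[OF True] p(4) by (intro powr_mono2') auto
          then have "M * ?q \<le> M * ?k y" using M by (intro mult_left_mono) auto
          moreover have "(u y - u x) * ?k y \<le> (\<epsilon> * M - M) * ?k y"
            using inG[OF True] k by (intro mult_right_mono) auto
          ultimately show ?thesis using True by (simp add: left_diff_distrib)
        next
          case False
          then show ?thesis using mult_right_mono[OF max k] by simp
        qed
        then show ?thesis using False out by simp
      qed
    qed
    also have "\<dots> = a * integral\<^sup>L lebesgue ?near + \<epsilon> * M * integral\<^sup>L lebesgue ?far - M * ?q * measure lebesgue G"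
      using ints lin(2) by (simp add: Bochner_Integration.integral_add Bochner_Integration.integral_diff)
    also have "\<dots> \<le> a * (Ci * (r / 2) powr (2 - 2 * s)) + \<epsilon> * M * (Co * (r / 2) powr (- 2 * s))
        - M * ?q * (m * r ^ CARD('n))"
    proof -
      have "integral\<^sup>L lebesgue ?near \<le> Ci * (r / 2) powr (2 - 2 * s)"
        using Ci(3)[OF r2, of x] by (simp add: p_def)
      moreover have "integral\<^sup>L lebesgue ?far \<le> Co * (r / 2) powr (- 2 * s)"
        using Co(3)[OF r2, of x] by (simp add: p_def)
      ultimately show ?thesis
        using a M \<epsilon> G(2) by (intro diff_mono add_mono mult_left_mono) auto
    qed
    \<comment> \<open>All three terms scale alike: \<open>r powr - 2 * r powr (2 - 2 * s)\<close>,
      \<open>r powr (- 2 * s)\<close> and \<open>r powr - p * r ^ CARD('n)\<close> agree.\<close>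
    also have "\<dots> = M * r powr (- 2 * s) * (\<epsilon> * \<kappa> - m * (c1 + 1) powr - p)"
    proof -
      have half: "(r / 2) powr t = r powr t * (1 / 2) powr t" for t
        using powr_mult[of r "1/2" t] r by simp
      have 1: "r powr (2 - 2 * s) = r\<^sup>2 * r powr (- 2 * s)"
        using r by (simp add: powr_add[symmetric] flip: powr_numeral)
      have 2: "?q * r ^ CARD('n) = (c1 + 1) powr - p * r powr (- 2 * s)"
      proof -
        have "?q * r ^ CARD('n) = (c1 + 1) powr - p * (r powr - p * r powr real CARD('n))"
          using r c1 by (simp add: powr_mult powr_realpow)
        also have "r powr - p * r powr real CARD('n) = r powr (- 2 * s)"
          by (simp add: powr_add[symmetric] p_def)
        finally show ?thesis .
      qed
      have "a * (Ci * (r / 2) powr (2 - 2 * s)) = M * r powr (- 2 * s) * (\<epsilon> * (4 * Ci * (1 / 2) powr (2 - 2 * s)))"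
        unfolding half 1 a_def using r by simp
      moreover have "M * ?q * (m * r ^ CARD('n)) = M * m * ((c1 + 1) powr - p * r powr (- 2 * s))"
        unfolding 2[symmetric] by simp
      ultimately show ?thesis unfolding \<kappa>_def half[of "- 2 * s"] by (simp only:) (simp add: algebra_simps)
    qed
    finally show ?thesis .
  qed
  ultimately show thesis using that by blast
qed

section \<open>Volume of annuli and rigidity at a zero\<close>

lemma measure_annulus:
  fixes x :: "'a::euclidean_space"
  assumes "0 < r" "1 < c"
  shows "measure lebesgue (ball x (c * r) - ball x r) = unit_ball_vol (real DIM('a)) * (c ^ DIM('a) - 1) * r ^ DIM('a)"
proof -
  have "ball x r \<subseteq> ball x (c * r)" using assms by (intro subset_ball) simp
  then have "measure lebesgue (ball x (c * r) - ball x r) = measure lebesgue (ball x (c * r)) - measure lebesgue (ball x r)"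
    by (intro measurable_measure_Diff) auto
  then show ?thesis using assms by (simp add: content_ball algebra_simps power_mult_distrib)
qed

lemma fractional_laplacian_eq_0:
  fixes u :: "real ^ 'n \<Rightarrow> real"
  assumes s: "0 < s" and u: "u \<in> Ls_space s" and le: "\<And>y. u y \<le> 0" and "u x = 0" and "0 \<le> l"
  defines "p \<equiv> real CARD('n) + 2 * s"
  assumes l: "((\<lambda>e. LINT y:- ball x e|lebesgue. (u y - u x) * norm (y - x) powr - p) \<longlongrightarrow> l) (at_right 0)"
  shows "AE y in lebesgue. u y = 0"
proof -
  define f where "f e y = indicator (- ball x e) y * (\<bar>u y\<bar> * norm (y - x) powr - p)" for e y
  define I where "I e = integral\<^sup>L lebesgue (f e)" for e
  have f: "integrable lebesgue (f e)" if "0 < e" for e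
    unfolding f_def p_def by (rule Ls_space_integrable_outside_ball[OF u s that])
  have f0: "0 \<le> f e y" for e y unfolding f_def by simp
  have "(LINT y:- ball x e|lebesgue. (u y - u x) * norm (y - x) powr - p) = (\<integral>y. - f e y \<partial>lebesgue)" for e
    unfolding set_lebesgue_integral_def f_def using le \<open>u x = 0\<close>
    by (intro Bochner_Integration.integral_cong) (auto simp: abs_of_nonpos)
  then have lim: "((\<lambda>e. - I e) \<longlongrightarrow> l) (at_right 0)" using l by (simp add: I_def)
  have I0: "I e = 0" if "0 < e" for e
  proof -
    \<comment> \<open>By monotonicity the limit \<open>l\<close> lies below every
      \<open>- I e\<close>, and \<open>0 \<le> l\<close> then leaves only
      \<open>I e = 0\<close>.\<close>
    have "\<forall>\<^sub>F e' in at_right 0. - I e' \<le> - I e"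
    proof (rule eventually_at_rightI[OF _ that])
      fix e' assume e': "e' \<in> {0<..<e}"
      then have "f e y \<le> f e' y" for y unfolding f_def by (auto simp: indicator_def)
      then have "I e \<le> I e'" unfolding I_def using e' that by (intro integral_mono f) auto
      then show "- I e' \<le> - I e" by simp
    qed
    then have "l \<le> - I e" by (intro tendsto_upperbound[OF lim]) auto
    moreover have "0 \<le> I e" unfolding I_def by (intro integral_nonneg_AE AE_I2 f0)
    ultimately show ?thesis using \<open>0 \<le> l\<close> by simp
  qed
  \<comment> \<open>Countably many radii tending to zero suffice to combine the null sets, and every
    \<open>y \<noteq> x\<close> lies outside one of these balls.\<close>
  have "AE y in lebesgue. f (inverse (real (Suc k))) y = 0" for k
    using integral_nonneg_eq_0_iff_AE[OF f, of "inverse (real (Suc k))"] I0[of "inverse (real (Suc k))"]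
    by (simp add: I_def f0)
  then have "AE y in lebesgue. \<forall>k. f (inverse (real (Suc k))) y = 0" by (simp add: AE_all_countable)
  then show ?thesis
  proof eventually_elim
    case (elim y)
    show "u y = 0"
    proof (cases "y = x")
      case False
      then obtain k where "inverse (real (Suc k)) < dist x y" using reals_Archimedean[of "dist x y"] by auto
      then have "y \<in> - ball x (inverse (real (Suc k)))" by simp
      moreover have "norm (y - x) powr - p \<noteq> 0" using False by simp
      ultimately show ?thesis using elim[rule_format, of k] unfolding f_def by simp
    qed (use \<open>u x = 0\<close> in simp)
  qed
qed

section \<open>The maximum principle: constants, weak form, strong form\<close>

lemma infdist_compl_le_width: "x \<in> D \<Longrightarrow> ereal (infdist x (- D)) \<le> width D"
  unfolding width_def by (rule SUP_upper)

theorem theorem4p4: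
  fixes s \<theta> \<Theta> c0 c1 :: real
  assumes "CARD('n::finite) \<ge> 2" and "0 < s" and "s < 1"
    and "0 < \<theta>" and "\<theta> \<le> \<Theta>" and "c0 > 0" and "c1 > 1"
  shows "\<exists>C>0. \<forall>(D :: (real ^ 'n) set) (\<Gamma> :: (real ^ 'n) set)
           (u :: real ^ 'n \<Rightarrow> real) (c :: real ^ 'n \<Rightarrow> real).
      open D \<and>
      open \<Gamma> \<and> connected \<Gamma> \<and> \<not> bounded \<Gamma> \<and> \<Gamma> \<subseteq> - closure D \<and>
      (\<forall>x\<in>D. let r = infdist x (- D) in
         measure lebesgue (\<Gamma> \<inter> (ball x (c1 * r) - ball x r))
           / measure lebesgue (ball x (c1 * r) - ball x r) \<ge> c0) \<and>
      u \<in> Ls_space s \<inter> C11_loc D \<and>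
      bdd_above (range u) \<and>
      (\<forall>x\<in>D. u x > 0 \<longrightarrow> Fs s \<theta> \<Theta> u x - c x * u x \<ge> 0) \<and>
      (\<forall>x\<in>- D. u x \<le> 0) \<and>
      bdd_below (c ` {x\<in>D. u x > 0}) \<and>
      (INF x\<in>{x\<in>D. u x > 0}. ereal (c x)) > - (ereal C / (4 * ereal_powr (width D) (2 * s)))
      \<longrightarrow>
      (\<forall>x\<in>D. u x \<le> 0) \<and>
      ((\<forall>x\<in>D. u x = 0 \<longrightarrow> Fs s \<theta> \<Theta> u x \<ge> 0) \<longrightarrow>
        (\<forall>x\<in>D. u x < 0) \<or> (AE x in lebesgue. u x = 0))"
proof -
  define p where "p = real CARD('n) + 2 * s"
  \<comment> \<open>By the density hypothesis \<open>m * r ^ CARD('n)\<close> bounds the measure of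
    the part of \<open>\<Gamma>\<close> in the annulus from below; \<open>\<eta>\<close> is its
    resulting gain in the integral.\<close>
  define m where "m = c0 * (unit_ball_vol (real CARD('n)) * (c1 ^ CARD('n) - 1))"
  define \<eta> where "\<eta> = m * (c1 + 1) powr - p"
  \<comment> \<open>Half of the gain is sacrificed to the penalization error;
    \<open>\<theta> powr p\<close> comes from the kernel of the matrix
    \<open>\<theta> I\<close>.\<close>
  define C where "C = \<theta> powr p * (\<eta> / 2)"
  have "1 < c1 ^ CARD('n)" using assms by (intro one_less_power) auto
  then have m: "0 < m" unfolding m_def using assms by (intro mult_pos_pos) auto
  then have \<eta>: "0 < \<eta>" unfolding \<eta>_def using assms by simp
  then have C: "0 < C" unfolding C_def using assms by simp
  obtain \<kappa> where \<kappa>: "0 < \<kappa>"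
    "\<And>u :: real ^ 'n \<Rightarrow> real. \<And>x x0 r M \<epsilon> G e.
      \<lbrakk>u \<in> Ls_space s; 0 < M; 0 < \<epsilon>; 0 < e; e < r / 2;
       \<And>y. u y - u x \<le> \<epsilon> * M * (4 / r\<^sup>2) * ((dist x0 y)\<^sup>2 - (dist x0 x)\<^sup>2);
       \<And>y. u y - u x \<le> \<epsilon> * M; G \<in> lmeasurable; m * r ^ CARD('n) \<le> measure lebesgue G;
       \<And>y. y \<in> G \<Longrightarrow> u y - u x \<le> \<epsilon> * M - M \<and> r / 2 \<le> norm (y - x) \<and> norm (y - x) \<le> (c1 + 1) * r\<rbrakk>
      \<Longrightarrow> (LINT y:- ball x e|lebesgue. (u y - u x) * norm (y - x) powr - p)
        \<le> M * r powr (- 2 * s) * (\<epsilon> * \<kappa> - m * (c1 + 1) powr - p)"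
    by (rule truncated_integral_at_penalized_maximum[OF assms(1-3,7), of m, folded p_def]) blast
  \<comment> \<open>The first entry keeps \<open>(1 - \<epsilon>) * M\<close> positive, the second
    makes the error at most half the gain. The choice involves neither \<open>D\<close> nor
    \<open>u\<close>.\<close>
  define \<epsilon> where "\<epsilon> = min (1 / 2) (\<eta> / (2 * \<kappa>))"
  have \<epsilon>: "0 < \<epsilon>" "\<epsilon> < 1" "\<epsilon> * \<kappa> \<le> \<eta> / 2"
    using \<eta> \<kappa>(1) by (auto simp: \<epsilon>_def min_def field_simps)
  have "(\<forall>x\<in>D. u x \<le> 0) \<and>
      ((\<forall>x\<in>D. u x = 0 \<longrightarrow> Fs s \<theta> \<Theta> u x \<ge> 0) \<longrightarrow>
        (\<forall>x\<in>D. u x < 0) \<or> (AE x in lebesgue. u x = 0))"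
    if "open D" "open \<Gamma>" "\<not> bounded \<Gamma>" "\<Gamma> \<subseteq> - closure D"
      and density: "\<forall>x\<in>D. let r = infdist x (- D) in
         measure lebesgue (\<Gamma> \<inter> (ball x (c1 * r) - ball x r))
           / measure lebesgue (ball x (c1 * r) - ball x r) \<ge> c0"
      and u: "u \<in> Ls_space s" "u \<in> C11_loc D" and bdd: "bdd_above (range u)"
      and sub: "\<forall>x\<in>D. u x > 0 \<longrightarrow> Fs s \<theta> \<Theta> u x - c x * u x \<ge> 0"
      and out: "\<forall>x\<in>- D. u x \<le> 0"
      and cinf: "(INF x\<in>{x\<in>D. u x > 0}. ereal (c x)) > - (ereal C / (4 * ereal_powr (width D) (2 * s)))"
    for D \<Gamma> :: "(real ^ 'n) set" and u c :: "real ^ 'n \<Rightarrow> real"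
  proof -
    have "\<Gamma> \<noteq> {}" using \<open>\<not> bounded \<Gamma>\<close> by auto
    \<comment> \<open>With a nonempty complement \<open>infdist\<close> is the true distance, hence
      positive at points of the open set \<open>D\<close>.\<close>
    then have nonempty: "- D \<noteq> {}" and \<Gamma>D: "\<Gamma> \<subseteq> - D"
      using \<open>\<Gamma> \<subseteq> - closure D\<close> closure_subset by blast+
    have weak: "\<forall>x\<in>D. u x \<le> 0"
    proof (rule ccontr)
      assume "\<not> (\<forall>x\<in>D. u x \<le> 0)"
      then obtain z where z: "0 < u z" by (auto simp: not_le)
      define M where "M = (SUP y. u y)"
      have M: "u y \<le> M" for y unfolding M_def using bdd by (intro cSUP_upper) auto
      have Mpos: "0 < M" using z M[of z] by linarith
      have "(1 - \<epsilon>) * M < M" using \<epsilon> Mpos by simp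
      then obtain x0 where x0: "(1 - \<epsilon>) * M < u x0"
        using less_cSUP_iff[OF _ bdd, of "(1 - \<epsilon>) * M"] unfolding M_def[symmetric] by auto
      have "0 < (1 - \<epsilon>) * M" using \<epsilon> Mpos by simp
      then have x0D: "x0 \<in> D" using x0 out by (metis Compl_iff less_trans not_le)
      define r where "r = infdist x0 (- D)"
      have far: "r \<le> dist x0 y" if "y \<notin> D" for y
        unfolding r_def using that by (intro infdist_le) auto
      have r: "0 < r"
        unfolding r_def using \<open>open D\<close> x0D nonempty by (intro infdist_pos_not_in_closed) auto
      have "cball x0 (r / 2) \<subseteq> D"
      proof
        fix y assume "y \<in> cball x0 (r / 2)"
        then show "y \<in> D" using far[of y] r by fastforce
      qed
      then have cont: "continuous_on (cball x0 (r / 2)) u"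
        using continuous_on_C11_loc[OF u(2)] continuous_on_subset by blast
      obtain x where x: "dist x0 x < r / 2" "(1 - \<epsilon>) * M \<le> u x"
        and pen: "\<And>y. u y - u x \<le> \<epsilon> * M * (4 / r\<^sup>2) * ((dist x0 y)\<^sup>2 - (dist x0 x)\<^sup>2)"
        by (rule penalized_maximum[OF r cont M Mpos \<epsilon>(1) x0]) blast
      have ux: "0 < u x" using x(2) \<open>0 < (1 - \<epsilon>) * M\<close> by linarith
      then have xD: "x \<in> D" using out by (metis Compl_iff not_le)
      define G where "G = \<Gamma> \<inter> (ball x0 (c1 * r) - ball x0 r)"
      have G: "G \<in> lmeasurable"
        unfolding G_def using \<open>open \<Gamma>\<close>
        by (intro bounded_set_imp_lmeasurable) (auto intro: bounded_subset[OF bounded_ball])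
      have mG: "m * r ^ CARD('n) \<le> measure lebesgue G"
      proof -
        have "c0 \<le> measure lebesgue G / measure lebesgue (ball x0 (c1 * r) - ball x0 r)"
          using density x0D unfolding G_def r_def Let_def by blast
        moreover have "0 < unit_ball_vol (real CARD('n)) * (c1 ^ CARD('n) - 1) * r ^ CARD('n)"
          using \<open>1 < c1 ^ CARD('n)\<close> r by simp
        ultimately show ?thesis
          unfolding measure_annulus[OF r \<open>c1 > 1\<close>] m_def by (simp add: pos_le_divide_eq mult.assoc)
      qed
      \<comment> \<open>The density is centred at \<open>x0\<close>, the kernel at \<open>x\<close>.
        Moving the centre by less than \<open>r / 2\<close> keeps distances between
        \<open>r / 2\<close> and \<open>(c1 + 1) * r\<close>.\<close>
      have inG: "u y - u x \<le> \<epsilon> * M - M \<and> r / 2 \<le> norm (y - x) \<and> norm (y - x) \<le> (c1 + 1) * r" if "y \<in> G" for y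
      proof -
        have y: "u y \<le> 0" "r \<le> dist x0 y" "dist x0 y < c1 * r"
          using that \<Gamma>D out unfolding G_def by auto
        have "dist x0 y \<le> dist x0 x + dist x y" "dist x y \<le> dist x0 x + dist x0 y"
          using dist_triangle[of x0 y x] dist_triangle[of x y x0] by (auto simp: dist_commute)
        with x(1) y have "r / 2 \<le> dist x y" "dist x y \<le> (c1 + 1) * r"
          using r by (auto simp: algebra_simps)
        moreover have "u y - u x \<le> \<epsilon> * M - M" using y(1) x(2) by (simp add: algebra_simps)
        ultimately show ?thesis by (simp add: dist_norm norm_minus_commute)
      qed
      obtain l where l: "((\<lambda>e. LINT y:- ball x e|lebesgue. (u y - u x) * norm (y - x) powr - p) \<longlongrightarrow> l) (at_right 0)"
        "Fs s \<theta> \<Theta> u x \<le> \<theta> powr p * l"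
        by (rule Fs_le_scaled_fractional_laplacian[OF assms(1-5) \<open>open D\<close> xD u, folded p_def]) blast
      let ?R = "r powr (- 2 * s)"
      have "l \<le> M * ?R * (\<epsilon> * \<kappa> - \<eta>)"
      proof (rule tendsto_upperbound[OF l(1)])
        have "r / 2 > 0" using r by simp
        then show "\<forall>\<^sub>F e in at_right 0. (LINT y:- ball x e|lebesgue. (u y - u x) * norm (y - x) powr - p)
            \<le> M * ?R * (\<epsilon> * \<kappa> - \<eta>)"
        proof (rule eventually_at_rightI[rotated])
          fix e assume e: "e \<in> {0<..<r / 2}"
          have max: "u y - u x \<le> \<epsilon> * M" for y using M[of y] x(2) by (simp add: algebra_simps)
          show "(LINT y:- ball x e|lebesgue. (u y - u x) * norm (y - x) powr - p) \<le> M * ?R * (\<epsilon> * \<kappa> - \<eta>)"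
            unfolding \<eta>_def using e by (intro \<kappa>(2)[OF u(1) Mpos \<epsilon>(1) _ _ pen max G mG inG]) auto
        qed
      qed simp
      also have "\<dots> \<le> M * ?R * (- (\<eta> / 2))" using \<epsilon>(3) Mpos by (intro mult_left_mono) auto
      finally have "\<theta> powr p * l \<le> \<theta> powr p * (M * ?R * (- (\<eta> / 2)))" by (intro mult_left_mono) auto
      also have "\<dots> = - C * ?R * M" by (simp add: C_def)
      finally have cu: "c x * u x \<le> - C * ?R * M" using l(2) sub xD ux by force
      also have "\<dots> < 0" using C Mpos r by simp
      finally have cneg: "c x < 0" using ux by (simp add: mult_less_0_iff)
      \<comment> \<open>Because \<open>c x\<close> is negative, replacing \<open>u x\<close> by the
        larger \<open>M\<close> lowers the product, and \<open>M\<close> can be cancelled.\<close>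
      then have "c x * M \<le> c x * u x" using M[of x] by simp
      with cu have "c x * M \<le> (- C * ?R) * M" by simp
      then have cle: "c x \<le> - C * ?R" using Mpos by (simp only: mult_le_cancel_right_pos)
      have "- (ereal C / (4 * ereal_powr (width D) (2 * s))) < ereal (c x)"
        using cinf INF_lower[of x "{x\<in>D. u x > 0}" "\<lambda>x. ereal (c x)"] xD ux
        by (auto intro: less_le_trans)
      \<comment> \<open>For finite width, \<open>r \<le> d\<close> suffices with a factor
        \<open>4\<close> to spare. For infinite width the quotient is \<open>0\<close>, so the sign
        of \<open>c x\<close> decides. The value \<open>-\<infinity>\<close> is excluded by
        \<open>x0 \<in> D\<close>.\<close>
      moreover have "ereal (c x) \<le> - (ereal C / (4 * ereal_powr (width D) (2 * s)))"
      proof (cases "width D")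
        case (real d)
        have rd: "r \<le> d" using infdist_compl_le_width[OF x0D] unfolding r_def real by simp
        then have "d powr (- 2 * s) \<le> ?R" using r assms by (intro powr_mono2') auto
        then have "C * d powr (- 2 * s) \<le> C * ?R" using C by simp
        with cle have "c x \<le> - (C * d powr (- 2 * s))" by simp
        also have "\<dots> \<le> - (C * d powr (- 2 * s) / 4)" using C by simp
        finally have "c x \<le> - (C / (4 * d powr (2 * s)))"
          using powr_minus[of d "2 * s"] by (simp add: field_simps)
        then show ?thesis using real rd r by (simp add: ereal_powr_def)
      next
        case PInf
        then show ?thesis using cneg by (simp add: ereal_powr_def)
      next
        case MInf
        then show ?thesis using infdist_compl_le_width[OF x0D] by simp
      qed
      ultimately show False by simp
    qed
    have le0: "u y \<le> 0" for y using weak out by (cases "y \<in> D") auto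
    show ?thesis
    proof (intro conjI weak impI disjCI)
      \<comment> \<open>A single zero in \<open>D\<close> would already force the almost-everywhere
        alternative, so its failure leaves strict negativity.\<close>
      assume F0: "\<forall>x\<in>D. u x = 0 \<longrightarrow> Fs s \<theta> \<Theta> u x \<ge> 0" and *: "\<not> (AE x in lebesgue. u x = 0)"
      show "\<forall>x\<in>D. u x < 0"
      proof (rule ccontr)
        assume "\<not> (\<forall>x\<in>D. u x < 0)"
        then obtain x where x: "x \<in> D" "u x = 0" using le0 by (meson antisym not_le)
        obtain l where l: "((\<lambda>e. LINT y:- ball x e|lebesgue. (u y - u x) * norm (y - x) powr - p) \<longlongrightarrow> l) (at_right 0)"
          "Fs s \<theta> \<Theta> u x \<le> \<theta> powr p * l"
          by (rule Fs_le_scaled_fractional_laplacian[OF assms(1-5) \<open>open D\<close> x(1) u, folded p_def]) blast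
        have "0 \<le> \<theta> powr p * l" using F0 x l(2) order_trans by blast
        then have "0 \<le> l" using \<open>0 < \<theta>\<close> by (simp add: zero_le_mult_iff)
        then show False
          using * fractional_laplacian_eq_0[OF \<open>0 < s\<close> u(1) le0 x(2) _ l(1)[unfolded p_def]] by blast
      qed
    qed
  qed
  then show ?thesis using C by (intro exI[of _ C] conjI allI impI) (assumption | elim conjE IntE | blast)+
qed

end
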